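(* Let $G$ be a group and let $\mathcal{R}=\mathcal{R}_e \rtimes_{\sigma} G$ be a skew group ring with $\mathcal{R}_e$ commutative. The following two assertions are equivalent: (i) The ring $\mathcal{R}_e$ is a maximal commutative subring in $\mathcal{R}$. (ii) $I \cap \mathcal{R}_e \neq \{0\}$ for each nonzero ideal $I$ in $\mathcal{R}$.
   Context: All rings are associative and unital; $G$ is an arbitrary group with neutral element $e$. Given a ring $\mathcal{R}_e$ and a group homomorphism $\sigma: G\to \mathrm{Aut}(\mathcal{R}_e)$, $g\mapsto\sigma_g$, the skew group ring $\mathcal{R}_e\rtimes_\sigma G$ is the free left $\mathcal{R}_e$-module with basis $\{u_g\}_{g\in G}$, with multiplication determined by $(a\,u_g)(b\,u_h)=a\,\sigma_g(b)\,u_{gh}$ for $a,b\in\mathcal{R}_e$, $g,h\in G$; $\mathcal{R}_e$ is identified with the subring $\mathcal{R}_e u_e$. A commutative subring $S$ of $\mathcal{R}$ is maximal commutative in $\mathcal{R}$ if every element of $\mathcal{R}$ commuting with all of $S$ lies in $S$. Ideals are two-sided. *)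

theory Defs
  imports "HOL-Algebra.Subrings" "HOL-Algebra.Bij"
begin

text \<open>
  As in the library's \<open>AutoGroup\<close>, automorphisms are taken extensional outside the carrier, so that
  each automorphism of the ring is represented by exactly one HOL function.
\<close>

definition ring_auto :: "('a, 'm) ring_scheme \<Rightarrow> ('a \<Rightarrow> 'a) set"
  where "ring_auto R = ring_iso R R \<inter> extensional (carrier R)"

definition ring_AutoGroup :: "('a, 'm) ring_scheme \<Rightarrow> ('a \<Rightarrow> 'a) monoid"
  where "ring_AutoGroup R = BijGroup (carrier R) \<lparr>carrier := ring_auto R\<rparr>"

definition skew_support ::
  "('a, 'm) ring_scheme \<Rightarrow> ('g, 'n) monoid_scheme \<Rightarrow> ('g \<Rightarrow> 'a) \<Rightarrow> 'g set"
  where "skew_support R G f = {g \<in> carrier G. f g \<noteq> \<zero>\<^bsub>R\<^esub>}"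

text \<open>The element \<open>a u\<^sub>g\<close>.\<close>

definition skew_monom ::
  "('a, 'm) ring_scheme \<Rightarrow> ('g, 'n) monoid_scheme \<Rightarrow> 'a \<Rightarrow> 'g \<Rightarrow> ('g \<Rightarrow> 'a)"
  where "skew_monom R G a g = (\<lambda>h\<in>carrier G. if h = g then a else \<zero>\<^bsub>R\<^esub>)"

text \<open>
  An element \<open>\<Sum>\<^sub>g f g u\<^sub>g\<close> is represented by its finitely supported family \<open>f\<close> of coefficients.
  By \<open>(a u\<^sub>g)(b u\<^sub>h) = a \<sigma>\<^sub>g(b) u\<^sub>g\<^sub>h\<close>, the coefficient of a product at \<open>k\<close> collects the pairs
  \<open>(g, h)\<close> with \<open>h = g\<^sup>-\<^sup>1k\<close>.
\<close>

definition skew_group_ring ::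
  "('a, 'm) ring_scheme \<Rightarrow> ('g, 'n) monoid_scheme \<Rightarrow> ('g \<Rightarrow> 'a \<Rightarrow> 'a) \<Rightarrow> ('g \<Rightarrow> 'a) ring"
  where "skew_group_ring R G \<sigma> =
    \<lparr>carrier = {f \<in> carrier G \<rightarrow>\<^sub>E carrier R. finite (skew_support R G f)},
     mult = (\<lambda>f h. \<lambda>k\<in>carrier G.
       \<Oplus>\<^bsub>R\<^esub>g\<in>skew_support R G f. f g \<otimes>\<^bsub>R\<^esub> \<sigma> g (h (inv\<^bsub>G\<^esub> g \<otimes>\<^bsub>G\<^esub> k))),
     one = skew_monom R G \<one>\<^bsub>R\<^esub> \<one>\<^bsub>G\<^esub>,
     zero = (\<lambda>k\<in>carrier G. \<zero>\<^bsub>R\<^esub>),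
     add = (\<lambda>f h. \<lambda>k\<in>carrier G. f k \<oplus>\<^bsub>R\<^esub> h k)\<rparr>"

text \<open>The coefficient ring inside the skew group ring, i.e. the set of all \<open>a u\<^sub>e\<close>.\<close>

definition skew_base :: "('a, 'm) ring_scheme \<Rightarrow> ('g, 'n) monoid_scheme \<Rightarrow> ('g \<Rightarrow> 'a) set"
  where "skew_base R G = (\<lambda>a. skew_monom R G a \<one>\<^bsub>G\<^esub>) ` carrier R"

definition maximal_commutative_subring :: "'a set \<Rightarrow> ('a, 'm) ring_scheme \<Rightarrow> bool"
  where "maximal_commutative_subring S R \<longleftrightarrow>
    subcring S R \<and>
    (\<forall>x\<in>carrier R. (\<forall>s\<in>S. x \<otimes>\<^bsub>R\<^esub> s = s \<otimes>\<^bsub>R\<^esub> x) \<longrightarrow> x \<in> S)"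


section \<open>The construction yields a ring with the expected multiplication\<close>

lemma (in abelian_monoid) finsum_swap_finite:
  assumes "finite A" "finite B" "\<And>a b. a \<in> A \<Longrightarrow> b \<in> B \<Longrightarrow> f a b \<in> carrier G"
  shows "(\<Oplus>a\<in>A. \<Oplus>b\<in>B. f a b) = (\<Oplus>b\<in>B. \<Oplus>a\<in>A. f a b)"
  using assms(1,3)
proof (induction A rule: finite_induct)
  case empty
  then show ?case by simp
next
  case (insert x F)
  have "(\<Oplus>a\<in>insert x F. \<Oplus>b\<in>B. f a b) = (\<Oplus>b\<in>B. f x b) \<oplus> (\<Oplus>b\<in>B. \<Oplus>a\<in>F. f a b)"
    using insert by (subst finsum_insert) (auto intro!: finsum_closed)
  also have "\<dots> = (\<Oplus>b\<in>B. f x b \<oplus> (\<Oplus>a\<in>F. f a b))"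
    using insert.prems by (subst finsum_addf) (auto intro!: finsum_closed)
  also have "\<dots> = (\<Oplus>b\<in>B. \<Oplus>a\<in>insert x F. f a b)"
    using insert by (intro finsum_cong') (auto intro!: finsum_closed)
  finally show ?case .
qed

lemma skew_group_ring_carrier:
  "carrier (skew_group_ring R G \<sigma>) = {f \<in> carrier G \<rightarrow>\<^sub>E carrier R. finite (skew_support R G f)}"
  by (simp add: skew_group_ring_def)

lemma skew_group_ring_sel:
  "f \<otimes>\<^bsub>skew_group_ring R G \<sigma>\<^esub> h = (\<lambda>k\<in>carrier G.
     \<Oplus>\<^bsub>R\<^esub>g\<in>skew_support R G f. f g \<otimes>\<^bsub>R\<^esub> \<sigma> g (h (inv\<^bsub>G\<^esub> g \<otimes>\<^bsub>G\<^esub> k)))"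
  "\<one>\<^bsub>skew_group_ring R G \<sigma>\<^esub> = skew_monom R G \<one>\<^bsub>R\<^esub> \<one>\<^bsub>G\<^esub>"
  "\<zero>\<^bsub>skew_group_ring R G \<sigma>\<^esub> = (\<lambda>k\<in>carrier G. \<zero>\<^bsub>R\<^esub>)"
  "f \<oplus>\<^bsub>skew_group_ring R G \<sigma>\<^esub> h = (\<lambda>k\<in>carrier G. f k \<oplus>\<^bsub>R\<^esub> h k)"
  unfolding skew_group_ring_def by simp_all

locale skew_system = R: ring R + G: group G
  for R :: "('a, 'm) ring_scheme" (structure) and G :: "('g, 'n) monoid_scheme" (structure) +
  fixes \<sigma> :: "'g \<Rightarrow> 'a \<Rightarrow> 'a"
  assumes sigma: "\<sigma> \<in> hom G (ring_AutoGroup R)"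
begin

abbreviation S where "S \<equiv> skew_group_ring R G \<sigma>"
abbreviation gm (infixl "\<cdot>" 70) where "x \<cdot> y \<equiv> x \<otimes>\<^bsub>G\<^esub> y"
abbreviation gi where "gi x \<equiv> inv\<^bsub>G\<^esub> x"
abbreviation supp where "supp \<equiv> skew_support R G"

lemma sigma_auto: "g \<in> carrier G \<Longrightarrow> \<sigma> g \<in> ring_auto R"
  using sigma by (auto simp: hom_def ring_AutoGroup_def)

lemma sigma_hom: "g \<in> carrier G \<Longrightarrow> \<sigma> g \<in> ring_hom R R"
  using sigma_auto by (auto simp: ring_auto_def ring_iso_def)

lemma sigma_Bij: "g \<in> carrier G \<Longrightarrow> \<sigma> g \<in> Bij (carrier R)"
  using sigma_auto by (auto simp: ring_auto_def ring_iso_def Bij_def)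

lemma sigma_closed [simp]: "g \<in> carrier G \<Longrightarrow> a \<in> carrier R \<Longrightarrow> \<sigma> g a \<in> carrier R"
  by (rule ring_hom_closed[OF sigma_hom])

lemma sigma_zero [simp]: "g \<in> carrier G \<Longrightarrow> \<sigma> g \<zero> = \<zero>"
  by (rule ring_hom_zero[OF sigma_hom R.ring_axioms R.ring_axioms])

lemma sigma_one [simp]: "g \<in> carrier G \<Longrightarrow> \<sigma> g \<one> = \<one>"
  by (rule ring_hom_one[OF sigma_hom])

lemma sigma_add:
  "g \<in> carrier G \<Longrightarrow> a \<in> carrier R \<Longrightarrow> b \<in> carrier R \<Longrightarrow> \<sigma> g (a \<oplus> b) = \<sigma> g a \<oplus> \<sigma> g b"
  by (rule ring_hom_add[OF sigma_hom])

lemma sigma_mult: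
  "g \<in> carrier G \<Longrightarrow> a \<in> carrier R \<Longrightarrow> b \<in> carrier R \<Longrightarrow> \<sigma> g (a \<otimes> b) = \<sigma> g a \<otimes> \<sigma> g b"
  by (rule ring_hom_mult[OF sigma_hom])

lemma sigma_comp:
  assumes "g \<in> carrier G" "h \<in> carrier G" "a \<in> carrier R"
  shows "\<sigma> (g \<cdot> h) a = \<sigma> g (\<sigma> h a)"
proof -
  have "\<sigma> (g \<cdot> h) = \<sigma> g \<otimes>\<^bsub>ring_AutoGroup R\<^esub> \<sigma> h"
    using hom_mult[OF sigma assms(1,2)] .
  also have "\<dots> = compose (carrier R) (\<sigma> g) (\<sigma> h)"
    using sigma_Bij assms by (simp add: ring_AutoGroup_def BijGroup_def)
  finally show ?thesis
    using assms by (simp add: compose_def)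
qed

lemma sigma_id:
  assumes "a \<in> carrier R"
  shows "\<sigma> \<one>\<^bsub>G\<^esub> a = a"
proof -
  have "\<sigma> \<one>\<^bsub>G\<^esub> (\<sigma> \<one>\<^bsub>G\<^esub> a) = \<sigma> \<one>\<^bsub>G\<^esub> a"
    using sigma_comp[of "\<one>\<^bsub>G\<^esub>" "\<one>\<^bsub>G\<^esub>" a] assms by simp
  moreover have "inj_on (\<sigma> \<one>\<^bsub>G\<^esub>) (carrier R)"
    using sigma_Bij[of "\<one>\<^bsub>G\<^esub>"] by (simp add: Bij_def bij_betw_def)
  ultimately show ?thesis
    using assms by (meson G.one_closed inj_on_def sigma_closed)
qed

lemma sigma_finsum:
  assumes "g \<in> carrier G" "finite A" "f \<in> A \<rightarrow> carrier R"
  shows "\<sigma> g (\<Oplus>i\<in>A. f i) = (\<Oplus>i\<in>A. \<sigma> g (f i))"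
  using assms(2,3)
proof (induction A rule: finite_induct)
  case empty
  then show ?case using assms(1) by simp
next
  case (insert x F)
  then have "f x \<in> carrier R" "f \<in> F \<rightarrow> carrier R" by auto
  moreover have "(\<lambda>i. \<sigma> g (f i)) \<in> F \<rightarrow> carrier R"
    using assms(1) insert.prems by (auto simp: Pi_iff)
  ultimately show ?case
    using insert assms(1) by (simp add: sigma_add)
qed

lemma S_carrier_iff:
  "f \<in> carrier S \<longleftrightarrow> f \<in> carrier G \<rightarrow>\<^sub>E carrier R \<and> finite (supp f)"
  by (simp add: skew_group_ring_carrier)

lemma S_closed [simp]: "f \<in> carrier S \<Longrightarrow> g \<in> carrier G \<Longrightarrow> f g \<in> carrier R"
  by (auto simp: S_carrier_iff)

lemma supp_finite: "f \<in> carrier S \<Longrightarrow> finite (supp f)"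
  by (simp add: S_carrier_iff)

lemma supp_sub: "supp f \<subseteq> carrier G"
  by (auto simp: skew_support_def)

lemma S_eqI:
  assumes "f \<in> carrier S" "h \<in> carrier S" "\<And>k. k \<in> carrier G \<Longrightarrow> f k = h k"
  shows "f = h"
  by (rule PiE_ext[of f "carrier G" "\<lambda>_. carrier R" h])
    (use assms in \<open>simp_all add: S_carrier_iff\<close>)

lemma S_carrierI:
  assumes "finite A" "f \<in> carrier G \<rightarrow>\<^sub>E carrier R" "\<And>k. k \<in> carrier G \<Longrightarrow> k \<notin> A \<Longrightarrow> f k = \<zero>"
  shows "f \<in> carrier S"
proof -
  have "supp f \<subseteq> A"
    using assms(3) by (auto simp: skew_support_def)
  then show ?thesis
    using assms(1,2) by (simp add: S_carrier_iff finite_subset)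
qed

lemma S_add: "k \<in> carrier G \<Longrightarrow> (f \<oplus>\<^bsub>S\<^esub> h) k = f k \<oplus> h k"
  by (simp add: skew_group_ring_sel)

lemma S_zero: "k \<in> carrier G \<Longrightarrow> \<zero>\<^bsub>S\<^esub> k = \<zero>"
  by (simp add: skew_group_ring_sel)

lemma S_one_eq: "\<one>\<^bsub>S\<^esub> = skew_monom R G \<one> \<one>\<^bsub>G\<^esub>"
  by (simp add: skew_group_ring_sel)

declare supp_finite [simp]

lemma S_mult_supset:
  assumes "f \<in> carrier S" "h \<in> carrier S" "k \<in> carrier G"
    "finite A" "supp f \<subseteq> A" "A \<subseteq> carrier G"
  shows "(f \<otimes>\<^bsub>S\<^esub> h) k = (\<Oplus>g\<in>A. f g \<otimes> \<sigma> g (h (gi g \<cdot> k)))"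
proof -
  have "(f \<otimes>\<^bsub>S\<^esub> h) k = (\<Oplus>g\<in>supp f. f g \<otimes> \<sigma> g (h (gi g \<cdot> k)))"
    using assms(3) by (simp add: skew_group_ring_sel)
  also have "\<dots> = (\<Oplus>g\<in>A. f g \<otimes> \<sigma> g (h (gi g \<cdot> k)))"
  proof (rule R.add.finprod_mono_neutral_cong_left)
    show "f i \<otimes> \<sigma> i (h (gi i \<cdot> k)) = \<zero>" if "i \<in> A - supp f" for i
    proof -
      have "i \<in> carrier G" "f i = \<zero>"
        using that assms by (auto simp: skew_support_def)
      then show ?thesis using assms by simp
    qed
    show "(\<lambda>g. f g \<otimes> \<sigma> g (h (gi g \<cdot> k))) \<in> A \<rightarrow> carrier R"
    proof
      fix g assume "g \<in> A"
      then have "g \<in> carrier G" using assms by auto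
      then show "f g \<otimes> \<sigma> g (h (gi g \<cdot> k)) \<in> carrier R" using assms by simp
    qed
  qed (use assms in auto)
  finally show ?thesis .
qed

lemma S_monom_closed:
  assumes "a \<in> carrier R" "g \<in> carrier G"
  shows "skew_monom R G a g \<in> carrier S"
  by (rule S_carrierI[of "{g}"]) (use assms in \<open>auto simp: skew_monom_def\<close>)

lemma S_add_closed:
  assumes "f \<in> carrier S" "h \<in> carrier S"
  shows "f \<oplus>\<^bsub>S\<^esub> h \<in> carrier S"
proof (rule S_carrierI[of "supp f \<union> supp h"])
  show "f \<oplus>\<^bsub>S\<^esub> h \<in> carrier G \<rightarrow>\<^sub>E carrier R"
    using assms by (auto simp: skew_group_ring_sel)
  show "(f \<oplus>\<^bsub>S\<^esub> h) k = \<zero>" if "k \<in> carrier G" "k \<notin> supp f \<union> supp h" for k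
    using that by (simp add: S_add skew_support_def)
qed (use assms in simp)

lemma S_mult_closed:
  assumes f: "f \<in> carrier S" and h: "h \<in> carrier S"
  shows "f \<otimes>\<^bsub>S\<^esub> h \<in> carrier S"
    and "supp (f \<otimes>\<^bsub>S\<^esub> h) \<subseteq> (\<lambda>(x, y). x \<cdot> y) ` (supp f \<times> supp h)"
proof -
  let ?C = "(\<lambda>(x, y). x \<cdot> y) ` (supp f \<times> supp h)"
  have mem: "(f \<otimes>\<^bsub>S\<^esub> h) k \<in> carrier R" if "k \<in> carrier G" for k
  proof -
    have "(\<lambda>g. f g \<otimes> \<sigma> g (h (gi g \<cdot> k))) \<in> supp f \<rightarrow> carrier R"
    proof
      fix g assume "g \<in> supp f"
      then have "g \<in> carrier G" by (simp add: skew_support_def)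
      then show "f g \<otimes> \<sigma> g (h (gi g \<cdot> k)) \<in> carrier R" using that f h by simp
    qed
    then show ?thesis
      using S_mult_supset[OF f h that supp_finite[OF f] subset_refl supp_sub] f by (simp add: R.finsum_closed)
  qed
  have ext: "f \<otimes>\<^bsub>S\<^esub> h \<in> extensional (carrier G)"
    by (simp add: skew_group_ring_sel)
  have zero: "(f \<otimes>\<^bsub>S\<^esub> h) k = \<zero>" if k: "k \<in> carrier G" "k \<notin> ?C" for k
  proof -
    have "f g \<otimes> \<sigma> g (h (gi g \<cdot> k)) = \<zero>" if g: "g \<in> supp f" for g
    proof -
      have gG: "g \<in> carrier G" using g supp_sub by auto
      have "gi g \<cdot> k \<notin> supp h"
      proof
        assume "gi g \<cdot> k \<in> supp h"
        then have "g \<cdot> (gi g \<cdot> k) \<in> ?C" using g by force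
        moreover have "g \<cdot> (gi g \<cdot> k) = k"
          using gG k by (simp flip: G.m_assoc)
        ultimately show False using k by simp
      qed
      then have "h (gi g \<cdot> k) = \<zero>" using gG k by (simp add: skew_support_def)
      then show ?thesis using gG f by simp
    qed
    then show ?thesis
      using S_mult_supset[OF f h k(1) supp_finite[OF f] subset_refl supp_sub] f
      by (simp add: R.add.finprod_one_eqI)
  qed
  show "f \<otimes>\<^bsub>S\<^esub> h \<in> carrier S"
    by (rule S_carrierI[of ?C]) (use f h mem ext zero in \<open>auto simp: PiE_def\<close>)
  show "supp (f \<otimes>\<^bsub>S\<^esub> h) \<subseteq> ?C"
    using zero by (auto simp: skew_support_def simp del: split_paired_All)
qed

lemma S_mult_assoc:
  assumes f: "f \<in> carrier S" and h: "h \<in> carrier S" and j: "j \<in> carrier S"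
  shows "(f \<otimes>\<^bsub>S\<^esub> h) \<otimes>\<^bsub>S\<^esub> j = f \<otimes>\<^bsub>S\<^esub> (h \<otimes>\<^bsub>S\<^esub> j)"
proof (rule S_eqI)
  fix k assume k: "k \<in> carrier G"
  let ?A = "supp f" and ?B = "supp h"
  let ?C = "(\<lambda>(x, y). x \<cdot> y) ` (?A \<times> ?B)"
  have A: "?A \<subseteq> carrier G" "finite ?A" and B: "?B \<subseteq> carrier G" "finite ?B"
    using supp_sub f h by auto
  have C: "?C \<subseteq> carrier G" "finite ?C"
    using A B by auto
  let ?t = "\<lambda>x z. (f x \<otimes> \<sigma> x (h (gi x \<cdot> z))) \<otimes> \<sigma> z (j (gi z \<cdot> k))"
  have t: "?t x z \<in> carrier R" if "x \<in> carrier G" "z \<in> carrier G" for x z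
    using that f h j k by simp
  have "((f \<otimes>\<^bsub>S\<^esub> h) \<otimes>\<^bsub>S\<^esub> j) k = (\<Oplus>z\<in>?C. (f \<otimes>\<^bsub>S\<^esub> h) z \<otimes> \<sigma> z (j (gi z \<cdot> k)))"
    using S_mult_closed[OF f h] j k C by (intro S_mult_supset)
  also have "\<dots> = (\<Oplus>z\<in>?C. \<Oplus>x\<in>?A. ?t x z)"
  proof (rule R.finsum_cong')
    fix z assume "z \<in> ?C"
    then have z: "z \<in> carrier G" using C by auto
    show "(f \<otimes>\<^bsub>S\<^esub> h) z \<otimes> \<sigma> z (j (gi z \<cdot> k)) = (\<Oplus>x\<in>?A. ?t x z)"
      unfolding S_mult_supset[OF f h z A(2) subset_refl A(1)]
      by (rule R.finsum_ldistr) (use z A f h j k in \<open>auto simp: subset_iff\<close>)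
  qed (use t A C in \<open>auto intro!: R.finsum_closed simp: subset_iff\<close>)
  also have "\<dots> = (\<Oplus>x\<in>?A. \<Oplus>z\<in>?C. ?t x z)"
    using t A C by (intro R.finsum_swap_finite) (auto simp: subset_iff)
  also have "\<dots> = (\<Oplus>x\<in>?A. f x \<otimes> \<sigma> x ((h \<otimes>\<^bsub>S\<^esub> j) (gi x \<cdot> k)))"
  proof (rule R.finsum_cong')
    fix x assume xA: "x \<in> ?A"
    then have x: "x \<in> carrier G" using A by auto
    let ?u = "\<lambda>y. h y \<otimes> \<sigma> y (j (gi y \<cdot> (gi x \<cdot> k)))"
    have u: "?u \<in> ?B \<rightarrow> carrier R"
      using B x k h j by (auto simp: subset_iff)
    have inj: "inj_on (\<lambda>y. x \<cdot> y) ?B"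
      using x B by (auto intro!: inj_onI simp: subset_iff)
    have "(\<Oplus>z\<in>?C. ?t x z) = (\<Oplus>z\<in>(\<lambda>y. x \<cdot> y) ` ?B. ?t x z)"
    proof (rule R.add.finprod_mono_neutral_cong_right)
      show "?t x z = \<zero>" if z: "z \<in> ?C - (\<lambda>y. x \<cdot> y) ` ?B" for z
      proof -
        have zG: "z \<in> carrier G" using z C by auto
        have eq: "x \<cdot> (gi x \<cdot> z) = z" using x zG by (simp flip: G.m_assoc)
        have "gi x \<cdot> z \<notin> ?B"
        proof
          assume "gi x \<cdot> z \<in> ?B"
          then have "x \<cdot> (gi x \<cdot> z) \<in> (\<lambda>y. x \<cdot> y) ` ?B" by (rule imageI)
          then show False using z eq by simp
        qed
        then have "h (gi x \<cdot> z) = \<zero>" using x zG by (simp add: skew_support_def)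
        then show ?thesis using x zG f j k by simp
      qed
    qed (use xA C t x in \<open>auto simp: subset_iff\<close>)
    also have "\<dots> = (\<Oplus>y\<in>?B. ?t x (x \<cdot> y))"
      using inj t x B by (intro R.finsum_reindex) (auto simp: subset_iff)
    also have "\<dots> = (\<Oplus>y\<in>?B. f x \<otimes> \<sigma> x (?u y))"
    proof (rule R.finsum_cong')
      fix y assume "y \<in> ?B"
      then have y: "y \<in> carrier G" using B by auto
      have 1: "gi x \<cdot> (x \<cdot> y) = y" using x y by (simp flip: G.m_assoc)
      have 2: "gi (x \<cdot> y) \<cdot> k = gi y \<cdot> (gi x \<cdot> k)"
        using x y k by (simp add: G.inv_mult_group G.m_assoc)
      show "?t x (x \<cdot> y) = f x \<otimes> \<sigma> x (?u y)"
        unfolding 1 2 using x y k f h j by (simp add: sigma_comp sigma_mult R.m_assoc)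
    qed (use x f u in \<open>auto simp: Pi_iff\<close>)
    also have "\<dots> = f x \<otimes> (\<Oplus>y\<in>?B. \<sigma> x (?u y))"
      using x f u B by (intro R.finsum_rdistr[symmetric]) (auto simp: Pi_iff)
    also have "(\<Oplus>y\<in>?B. \<sigma> x (?u y)) = \<sigma> x (\<Oplus>y\<in>?B. ?u y)"
      using sigma_finsum[OF x B(2) u] by simp
    also have "(\<Oplus>y\<in>?B. ?u y) = (h \<otimes>\<^bsub>S\<^esub> j) (gi x \<cdot> k)"
      using S_mult_supset[OF h j _ B(2) subset_refl B(1), of "gi x \<cdot> k"] x k by simp
    finally show "(\<Oplus>z\<in>?C. ?t x z) = f x \<otimes> \<sigma> x ((h \<otimes>\<^bsub>S\<^esub> j) (gi x \<cdot> k))" .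
  qed (use A k f S_mult_closed(1)[OF h j] in \<open>auto simp: subset_iff\<close>)
  also have "\<dots> = (f \<otimes>\<^bsub>S\<^esub> (h \<otimes>\<^bsub>S\<^esub> j)) k"
    using S_mult_supset[OF f S_mult_closed(1)[OF h j] k A(2) subset_refl A(1)] by simp
  finally show "((f \<otimes>\<^bsub>S\<^esub> h) \<otimes>\<^bsub>S\<^esub> j) k = (f \<otimes>\<^bsub>S\<^esub> (h \<otimes>\<^bsub>S\<^esub> j)) k" .
qed (use f h j in \<open>auto intro!: S_mult_closed(1)\<close>)

lemma S_monom_mult_left:
  assumes "a \<in> carrier R" "g \<in> carrier G" "f \<in> carrier S" "k \<in> carrier G"
  shows "(skew_monom R G a g \<otimes>\<^bsub>S\<^esub> f) k = a \<otimes> \<sigma> g (f (gi g \<cdot> k))"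
proof -
  have "supp (skew_monom R G a g) \<subseteq> {g}"
    by (auto simp: skew_support_def skew_monom_def split: if_splits)
  then have "(skew_monom R G a g \<otimes>\<^bsub>S\<^esub> f) k
      = (\<Oplus>x\<in>{g}. skew_monom R G a g x \<otimes> \<sigma> x (f (gi x \<cdot> k)))"
    using assms S_monom_closed by (intro S_mult_supset) auto
  also have "\<dots> = a \<otimes> \<sigma> g (f (gi g \<cdot> k))"
    using assms by (simp add: skew_monom_def)
  finally show ?thesis .
qed

lemma S_monom_mult:
  assumes "a \<in> carrier R" "b \<in> carrier R" "g \<in> carrier G" "h \<in> carrier G"
  shows "skew_monom R G a g \<otimes>\<^bsub>S\<^esub> skew_monom R G b h = skew_monom R G (a \<otimes> \<sigma> g b) (g \<cdot> h)"
proof (rule S_eqI)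
  fix k assume k: "k \<in> carrier G"
  have "gi g \<cdot> k = h \<longleftrightarrow> k = g \<cdot> h"
    using assms k G.inv_solve_left by metis
  then show "(skew_monom R G a g \<otimes>\<^bsub>S\<^esub> skew_monom R G b h) k
      = skew_monom R G (a \<otimes> \<sigma> g b) (g \<cdot> h) k"
    using S_monom_mult_left[OF assms(1,3) S_monom_closed[OF assms(2,4)] k] assms k
    by (simp add: skew_monom_def)
qed (use assms in \<open>auto intro!: S_mult_closed(1) S_monom_closed\<close>)

lemma S_one_left:
  assumes "f \<in> carrier S"
  shows "\<one>\<^bsub>S\<^esub> \<otimes>\<^bsub>S\<^esub> f = f"
proof (rule S_eqI)
  fix k assume "k \<in> carrier G"
  then show "(\<one>\<^bsub>S\<^esub> \<otimes>\<^bsub>S\<^esub> f) k = f k"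
    using assms by (simp add: S_one_eq S_monom_mult_left sigma_id)
qed (use assms S_one_eq in \<open>auto intro!: S_mult_closed(1) S_monom_closed\<close>)

lemma S_one_right:
  assumes "f \<in> carrier S"
  shows "f \<otimes>\<^bsub>S\<^esub> \<one>\<^bsub>S\<^esub> = f"
proof (rule S_eqI)
  fix k assume k: "k \<in> carrier G"
  have one: "\<one>\<^bsub>S\<^esub> \<in> carrier S"
    by (simp add: S_one_eq S_monom_closed)
  have "(f \<otimes>\<^bsub>S\<^esub> \<one>\<^bsub>S\<^esub>) k = (\<Oplus>g\<in>insert k (supp f). f g \<otimes> \<sigma> g (\<one>\<^bsub>S\<^esub> (gi g \<cdot> k)))"
    using assms one k supp_sub by (intro S_mult_supset) auto
  also have "\<dots> = (\<Oplus>g\<in>insert k (supp f). if g = k then f g else \<zero>)"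
  proof (rule R.finsum_cong')
    fix g assume "g \<in> insert k (supp f)"
    then have g: "g \<in> carrier G" using k supp_sub by auto
    have "gi g \<cdot> k = \<one>\<^bsub>G\<^esub> \<longleftrightarrow> g = k"
      using g k by (metis G.inv_equality G.inv_inv G.inv_closed G.l_inv)
    then show "f g \<otimes> \<sigma> g (\<one>\<^bsub>S\<^esub> (gi g \<cdot> k)) = (if g = k then f g else \<zero>)"
      using g k assms by (auto simp: S_one_eq skew_monom_def)
  qed (use assms k supp_sub in \<open>auto simp: subset_iff\<close>)
  also have "\<dots> = f k"
    using assms k supp_sub by (intro R.add.finprod_singleton_swap) (auto simp: subset_iff)
  finally show "(f \<otimes>\<^bsub>S\<^esub> \<one>\<^bsub>S\<^esub>) k = f k" .
qed (use assms S_one_eq in \<open>auto intro!: S_mult_closed(1) S_monom_closed\<close>)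

lemma S_l_distr:
  assumes f: "f \<in> carrier S" and h: "h \<in> carrier S" and j: "j \<in> carrier S"
  shows "(f \<oplus>\<^bsub>S\<^esub> h) \<otimes>\<^bsub>S\<^esub> j = f \<otimes>\<^bsub>S\<^esub> j \<oplus>\<^bsub>S\<^esub> h \<otimes>\<^bsub>S\<^esub> j"
proof (rule S_eqI)
  fix k assume k: "k \<in> carrier G"
  let ?A = "supp f \<union> supp h"
  have A: "finite ?A" "?A \<subseteq> carrier G" using f h supp_sub by auto
  have fh: "f \<oplus>\<^bsub>S\<^esub> h \<in> carrier S" using f h by (rule S_add_closed)
  have sub: "supp (f \<oplus>\<^bsub>S\<^esub> h) \<subseteq> ?A"
    by (auto simp: skew_support_def S_add)
  have "((f \<oplus>\<^bsub>S\<^esub> h) \<otimes>\<^bsub>S\<^esub> j) k = (\<Oplus>g\<in>?A. (f \<oplus>\<^bsub>S\<^esub> h) g \<otimes> \<sigma> g (j (gi g \<cdot> k)))"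
    by (rule S_mult_supset[OF fh j k A(1) sub A(2)])
  also have "\<dots> = (\<Oplus>g\<in>?A. f g \<otimes> \<sigma> g (j (gi g \<cdot> k)) \<oplus> h g \<otimes> \<sigma> g (j (gi g \<cdot> k)))"
    by (rule R.finsum_cong')
      (use A f h j k in \<open>auto simp: subset_iff S_add R.l_distr\<close>)
  also have "\<dots> = (\<Oplus>g\<in>?A. f g \<otimes> \<sigma> g (j (gi g \<cdot> k))) \<oplus> (\<Oplus>g\<in>?A. h g \<otimes> \<sigma> g (j (gi g \<cdot> k)))"
    by (rule R.finsum_addf) (use A f h j k in \<open>auto simp: subset_iff\<close>)
  also have "\<dots> = (f \<otimes>\<^bsub>S\<^esub> j \<oplus>\<^bsub>S\<^esub> h \<otimes>\<^bsub>S\<^esub> j) k"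
    using S_mult_supset[OF f j k A(1) _ A(2)] S_mult_supset[OF h j k A(1) _ A(2)] k
    by (simp add: S_add)
  finally show "((f \<oplus>\<^bsub>S\<^esub> h) \<otimes>\<^bsub>S\<^esub> j) k = (f \<otimes>\<^bsub>S\<^esub> j \<oplus>\<^bsub>S\<^esub> h \<otimes>\<^bsub>S\<^esub> j) k" .
qed (use f h j in \<open>auto intro!: S_mult_closed(1) S_add_closed\<close>)

lemma S_r_distr:
  assumes f: "f \<in> carrier S" and h: "h \<in> carrier S" and j: "j \<in> carrier S"
  shows "j \<otimes>\<^bsub>S\<^esub> (f \<oplus>\<^bsub>S\<^esub> h) = j \<otimes>\<^bsub>S\<^esub> f \<oplus>\<^bsub>S\<^esub> j \<otimes>\<^bsub>S\<^esub> h"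
proof (rule S_eqI)
  fix k assume k: "k \<in> carrier G"
  let ?A = "supp j"
  have A: "finite ?A" "?A \<subseteq> carrier G" using j supp_sub by auto
  have fh: "f \<oplus>\<^bsub>S\<^esub> h \<in> carrier S" using f h by (rule S_add_closed)
  have "(j \<otimes>\<^bsub>S\<^esub> (f \<oplus>\<^bsub>S\<^esub> h)) k = (\<Oplus>g\<in>?A. j g \<otimes> \<sigma> g ((f \<oplus>\<^bsub>S\<^esub> h) (gi g \<cdot> k)))"
    by (rule S_mult_supset[OF j fh k A(1) subset_refl A(2)])
  also have "\<dots> = (\<Oplus>g\<in>?A. j g \<otimes> \<sigma> g (f (gi g \<cdot> k)) \<oplus> j g \<otimes> \<sigma> g (h (gi g \<cdot> k)))"
    by (rule R.finsum_cong')
      (use A f h j k in \<open>auto simp: subset_iff S_add R.r_distr sigma_add\<close>)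
  also have "\<dots> = (\<Oplus>g\<in>?A. j g \<otimes> \<sigma> g (f (gi g \<cdot> k))) \<oplus> (\<Oplus>g\<in>?A. j g \<otimes> \<sigma> g (h (gi g \<cdot> k)))"
    by (rule R.finsum_addf) (use A f h j k in \<open>auto simp: subset_iff\<close>)
  also have "\<dots> = (j \<otimes>\<^bsub>S\<^esub> f \<oplus>\<^bsub>S\<^esub> j \<otimes>\<^bsub>S\<^esub> h) k"
    using S_mult_supset[OF j f k A(1) subset_refl A(2)]
      S_mult_supset[OF j h k A(1) subset_refl A(2)] k
    by (simp add: S_add)
  finally show "(j \<otimes>\<^bsub>S\<^esub> (f \<oplus>\<^bsub>S\<^esub> h)) k = (j \<otimes>\<^bsub>S\<^esub> f \<oplus>\<^bsub>S\<^esub> j \<otimes>\<^bsub>S\<^esub> h) k" .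
qed (use f h j in \<open>auto intro!: S_mult_closed(1) S_add_closed\<close>)

theorem ring_skew_group_ring: "ring S"
proof (rule ringI)
  have zero: "\<zero>\<^bsub>S\<^esub> \<in> carrier S"
    by (rule S_carrierI[of "{}"]) (auto simp: skew_group_ring_sel)
  show "abelian_group S"
  proof (rule abelian_groupI)
    fix x y z assume "x \<in> carrier S" "y \<in> carrier S" "z \<in> carrier S"
    then show "x \<oplus>\<^bsub>S\<^esub> y \<oplus>\<^bsub>S\<^esub> z = x \<oplus>\<^bsub>S\<^esub> (y \<oplus>\<^bsub>S\<^esub> z)"
      by (intro S_eqI) (auto intro!: S_add_closed simp: S_add R.a_assoc)
  next
    fix x y assume "x \<in> carrier S" "y \<in> carrier S"
    then show "x \<oplus>\<^bsub>S\<^esub> y = y \<oplus>\<^bsub>S\<^esub> x"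
      by (intro S_eqI) (auto intro!: S_add_closed simp: S_add R.a_comm)
  next
    fix x assume x: "x \<in> carrier S"
    then show "\<zero>\<^bsub>S\<^esub> \<oplus>\<^bsub>S\<^esub> x = x"
      by (intro S_eqI) (auto intro!: S_add_closed zero simp: S_add S_zero)
    let ?y = "\<lambda>k\<in>carrier G. \<ominus> x k"
    have "?y \<in> carrier S"
      by (rule S_carrierI[OF supp_finite[OF x]]) (use x in \<open>auto simp: skew_support_def\<close>)
    moreover from this x have "?y \<oplus>\<^bsub>S\<^esub> x = \<zero>\<^bsub>S\<^esub>"
      by (intro S_eqI) (auto intro!: S_add_closed zero simp: S_add S_zero R.l_neg)
    ultimately show "\<exists>y\<in>carrier S. y \<oplus>\<^bsub>S\<^esub> x = \<zero>\<^bsub>S\<^esub>" by blast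
  qed (auto intro: S_add_closed zero)
  show "monoid S"
    by (rule monoidI)
      (auto simp: S_mult_closed(1) S_mult_assoc S_one_left S_one_right S_monom_closed
        simp flip: S_one_eq intro: S_monom_closed[of "\<one>" "\<one>\<^bsub>G\<^esub>", folded S_one_eq])
qed (auto intro: S_l_distr S_r_distr)

lemma S_finite_sum_of_monoms:
  assumes f: "f \<in> carrier S"
  shows "f = (\<Oplus>\<^bsub>S\<^esub>g\<in>supp f. skew_monom R G (f g) g)"
proof -
  interpret S: ring S by (rule ring_skew_group_ring)
  have mem: "(\<lambda>g. skew_monom R G (f g) g) \<in> A \<rightarrow> carrier S" if "A \<subseteq> carrier G" for A
    using that f by (auto intro!: S_monom_closed)
  have eval: "(\<Oplus>\<^bsub>S\<^esub>g\<in>A. skew_monom R G (f g) g) k = (if k \<in> A then f k else \<zero>)"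
    if "finite A" "A \<subseteq> carrier G" and k: "k \<in> carrier G" for A k
    using that(1,2)
  proof (induction A rule: finite_induct)
    case empty
    then show ?case using k by (simp add: S_zero)
  next
    case (insert x F)
    then have "(\<Oplus>\<^bsub>S\<^esub>g\<in>insert x F. skew_monom R G (f g) g)
        = skew_monom R G (f x) x \<oplus>\<^bsub>S\<^esub> (\<Oplus>\<^bsub>S\<^esub>g\<in>F. skew_monom R G (f g) g)"
      using mem[of F] f by (intro S.finsum_insert) (auto intro!: S_monom_closed)
    then have "(\<Oplus>\<^bsub>S\<^esub>g\<in>insert x F. skew_monom R G (f g) g) k
        = (if k = x then f x else \<zero>) \<oplus> (if k \<in> F then f k else \<zero>)"
      using insert k by (simp add: S_add skew_monom_def[of R G "f x"])
    then show ?case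
      using insert k f by auto
  qed
  show ?thesis
  proof (rule S_eqI[OF f])
    show "(\<Oplus>\<^bsub>S\<^esub>g\<in>supp f. skew_monom R G (f g) g) \<in> carrier S"
      using mem[OF supp_sub] by (rule S.finsum_closed)
    fix k assume k: "k \<in> carrier G"
    show "f k = (\<Oplus>\<^bsub>S\<^esub>g\<in>supp f. skew_monom R G (f g) g) k"
      using eval[OF supp_finite[OF f] supp_sub k] k by (simp add: skew_support_def split: if_splits)
  qed
qed

end

end

theory Submission
  imports Defs
begin

text \<open>
  Suppose that the coefficient ring \<open>R\<close> is maximal commutative, and choose a nonzero element of
  minimal support in a nonzero ideal. Multiplying it on the right by some \<open>u\<^sub>h\<close> moves a nonzero
  coefficient to the neutral element; call the result \<open>r\<close>. For \<open>a\<close> in \<open>R\<close> the commutator \<open>r a - a r\<close>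
  lies in the ideal, its support is contained in that of \<open>r\<close>, and its coefficient at the neutral
  element is \<open>0\<close> because \<open>R\<close> is commutative. By minimality the commutator vanishes. So \<open>r\<close> commutes
  with \<open>R\<close>, hence lies in \<open>R\<close>, and the ideal meets \<open>R\<close> nontrivially
  (\<open>ideal_meets_maximal_commutative_base\<close>).

  For the converse, \<open>R\<close> is a left module over the skew group ring: coefficients act by
  multiplication and \<open>u\<^sub>g\<close> acts as \<open>\<sigma> g\<close> (\<open>skew_act_mult\<close>). The annihilator of this module is an ideal
  that meets \<open>R\<close> only in \<open>0\<close>, since \<open>a\<close> sends \<open>1\<close> to \<open>a\<close>. So if every nonzero ideal meets \<open>R\<close>
  nontrivially, the module is faithful. But if an element commuting with \<open>R\<close> has a nonzero
  coefficient \<open>c\<close> at some \<open>g \<noteq> e\<close>, then \<open>c \<sigma>\<^sub>g(a) = c a\<close> for all \<open>a\<close>, which says exactly that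
  \<open>c u\<^sub>g - c u\<^sub>e\<close> annihilates \<open>R\<close> (\<open>skew_annihilator_nontrivial\<close>). A faithful module therefore forces
  everything that commutes with \<open>R\<close> to lie in \<open>R\<close>.
\<close>

section \<open>Coefficients of sums and products\<close>

context skew_system
begin

lemma skew_minus_apply:
  assumes f: "f \<in> carrier S" and h: "h \<in> carrier S" and k: "k \<in> carrier G"
  shows "(f \<ominus>\<^bsub>S\<^esub> h) k = f k \<ominus> h k"
proof -
  interpret S: ring S by (rule ring_skew_group_ring)
  have "(\<ominus>\<^bsub>S\<^esub> h) k \<oplus> h k = \<zero>"
    using S_add[OF k, of "\<ominus>\<^bsub>S\<^esub> h" h] h by (simp add: S.l_neg S_zero k)
  then have "(\<ominus>\<^bsub>S\<^esub> h) k = \<ominus> h k"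
    using h k R.minus_equality[of "(\<ominus>\<^bsub>S\<^esub> h) k" "h k"] by simp
  then show ?thesis
    by (simp add: a_minus_def S_add k)
qed

lemma skew_monom_mult_right:
  assumes f: "f \<in> carrier S" and a: "a \<in> carrier R" and h: "h \<in> carrier G" and k: "k \<in> carrier G"
  shows "(f \<otimes>\<^bsub>S\<^esub> skew_monom R G a h) k = f (k \<cdot> gi h) \<otimes> \<sigma> (k \<cdot> gi h) a"
proof -
  let ?x = "k \<cdot> gi h"
  have x: "?x \<in> carrier G" using h k by simp
  have A: "insert ?x (supp f) \<subseteq> carrier G" using x supp_sub by auto
  have "(f \<otimes>\<^bsub>S\<^esub> skew_monom R G a h) k
      = (\<Oplus>g\<in>insert ?x (supp f). f g \<otimes> \<sigma> g (skew_monom R G a h (gi g \<cdot> k)))"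
    using f a h k A by (intro S_mult_supset S_monom_closed) auto
  also have "\<dots> = (\<Oplus>g\<in>insert ?x (supp f). if g = ?x then f g \<otimes> \<sigma> g a else \<zero>)"
  proof (rule R.finsum_cong')
    fix g assume "g \<in> insert ?x (supp f)"
    then have g: "g \<in> carrier G" using A by auto
    have "gi g \<cdot> k = h \<longleftrightarrow> g = ?x"
      using g h k G.inv_solve_left[of h g k] G.inv_solve_right[of g k h] by auto
    then show "f g \<otimes> \<sigma> g (skew_monom R G a h (gi g \<cdot> k))
        = (if g = ?x then f g \<otimes> \<sigma> g a else \<zero>)"
      using g k f by (simp add: skew_monom_def)
  qed (use f a A in \<open>auto simp: subset_iff\<close>)
  also have "\<dots> = f ?x \<otimes> \<sigma> ?x a"
    using f a A by (intro R.add.finprod_singleton_swap) (auto simp: subset_iff)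
  finally show ?thesis .
qed

lemma skew_monom_one_apply:
  assumes "k \<in> carrier G"
  shows "skew_monom R G a \<one>\<^bsub>G\<^esub> k = (if k = \<one>\<^bsub>G\<^esub> then a else \<zero>)"
  using assms by (simp add: skew_monom_def)

lemma mem_skew_base_iff:
  assumes f: "f \<in> carrier S"
  shows "f \<in> skew_base R G \<longleftrightarrow> (\<forall>g\<in>carrier G. g \<noteq> \<one>\<^bsub>G\<^esub> \<longrightarrow> f g = \<zero>)"
proof
  assume "f \<in> skew_base R G"
  then show "\<forall>g\<in>carrier G. g \<noteq> \<one>\<^bsub>G\<^esub> \<longrightarrow> f g = \<zero>"
    by (auto simp: skew_base_def skew_monom_one_apply)
next
  assume 0: "\<forall>g\<in>carrier G. g \<noteq> \<one>\<^bsub>G\<^esub> \<longrightarrow> f g = \<zero>"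
  have "f = skew_monom R G (f \<one>\<^bsub>G\<^esub>) \<one>\<^bsub>G\<^esub>"
    using f 0 by (intro S_eqI S_monom_closed) (auto simp: skew_monom_one_apply)
  then show "f \<in> skew_base R G"
    unfolding skew_base_def by (rule image_eqI) (simp add: f)
qed

lemma ring_hom_skew_base: "ring_hom_ring R S (\<lambda>a. skew_monom R G a \<one>\<^bsub>G\<^esub>)"
proof (rule ring_hom_ringI)
  fix a b assume ab: "a \<in> carrier R" "b \<in> carrier R"
  then show "skew_monom R G (a \<otimes> b) \<one>\<^bsub>G\<^esub>
      = skew_monom R G a \<one>\<^bsub>G\<^esub> \<otimes>\<^bsub>S\<^esub> skew_monom R G b \<one>\<^bsub>G\<^esub>"
    by (simp add: S_monom_mult sigma_id)
  show "skew_monom R G (a \<oplus> b) \<one>\<^bsub>G\<^esub>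
      = skew_monom R G a \<one>\<^bsub>G\<^esub> \<oplus>\<^bsub>S\<^esub> skew_monom R G b \<one>\<^bsub>G\<^esub>"
    using ab by (intro S_eqI S_add_closed S_monom_closed) (auto simp: S_add skew_monom_one_apply)
qed (auto simp: S_one_eq intro: S_monom_closed R.ring_axioms ring_skew_group_ring)

section \<open>The coefficient ring as a module over the skew group ring\<close>

text \<open>
  The action of \<open>\<Sum>\<^sub>g f g u\<^sub>g\<close> on \<open>R\<close> that extends left multiplication by elements of \<open>R\<close> and lets \<open>u\<^sub>g\<close>
  act as \<open>\<sigma> g\<close>.
\<close>

definition skew_act :: "('g \<Rightarrow> 'a) \<Rightarrow> 'a \<Rightarrow> 'a"
  where "skew_act f a = (\<Oplus>g\<in>supp f. f g \<otimes> \<sigma> g a)"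

text \<open>
  Sums and products have supports that are only known up to inclusion; this allows the action to be
  summed over any convenient finite superset.
\<close>

lemma skew_act_supset:
  assumes "f \<in> carrier S" "a \<in> carrier R" "finite A" "supp f \<subseteq> A" "A \<subseteq> carrier G"
  shows "skew_act f a = (\<Oplus>g\<in>A. f g \<otimes> \<sigma> g a)"
  unfolding skew_act_def
proof (rule R.add.finprod_mono_neutral_cong_left)
  show "f i \<otimes> \<sigma> i a = \<zero>" if "i \<in> A - supp f" for i
    using that assms by (auto simp: skew_support_def)
qed (use assms in \<open>auto simp: subset_iff\<close>)

lemma skew_act_closed:
  assumes "f \<in> carrier S" "a \<in> carrier R"
  shows "skew_act f a \<in> carrier R"
  unfolding skew_act_def using assms supp_sub[of f]
  by (intro R.finsum_closed) (auto simp: subset_iff)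

lemma skew_act_zero_right: "f \<in> carrier S \<Longrightarrow> skew_act f \<zero> = \<zero>"
  unfolding skew_act_def using supp_sub[of f]
  by (intro R.add.finprod_one_eqI) (auto simp: subset_iff)

lemma skew_act_add:
  assumes f: "f \<in> carrier S" and h: "h \<in> carrier S" and a: "a \<in> carrier R"
  shows "skew_act (f \<oplus>\<^bsub>S\<^esub> h) a = skew_act f a \<oplus> skew_act h a"
proof -
  let ?A = "supp f \<union> supp h"
  have A: "finite ?A" "?A \<subseteq> carrier G" using f h supp_sub by auto
  have "supp (f \<oplus>\<^bsub>S\<^esub> h) \<subseteq> ?A"
    by (auto simp: skew_support_def S_add)
  then have "skew_act (f \<oplus>\<^bsub>S\<^esub> h) a = (\<Oplus>g\<in>?A. (f \<oplus>\<^bsub>S\<^esub> h) g \<otimes> \<sigma> g a)"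
    using A f h a by (intro skew_act_supset S_add_closed)
  also have "\<dots> = (\<Oplus>g\<in>?A. f g \<otimes> \<sigma> g a \<oplus> h g \<otimes> \<sigma> g a)"
    by (rule R.finsum_cong') (use A f h a in \<open>auto simp: subset_iff S_add R.l_distr\<close>)
  also have "\<dots> = (\<Oplus>g\<in>?A. f g \<otimes> \<sigma> g a) \<oplus> (\<Oplus>g\<in>?A. h g \<otimes> \<sigma> g a)"
    by (rule R.finsum_addf) (use A f h a in \<open>auto simp: subset_iff\<close>)
  also have "\<dots> = skew_act f a \<oplus> skew_act h a"
    using skew_act_supset[OF f a A(1) _ A(2)] skew_act_supset[OF h a A(1) _ A(2)] by simp
  finally show ?thesis .
qed

lemma skew_act_monom:
  assumes "a \<in> carrier R" "b \<in> carrier R" "g \<in> carrier G"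
  shows "skew_act (skew_monom R G a g) b = a \<otimes> \<sigma> g b"
proof -
  have "supp (skew_monom R G a g) \<subseteq> {g}"
    by (auto simp: skew_support_def skew_monom_def split: if_splits)
  then have "skew_act (skew_monom R G a g) b = (\<Oplus>x\<in>{g}. skew_monom R G a g x \<otimes> \<sigma> x b)"
    using assms by (intro skew_act_supset S_monom_closed) auto
  also have "\<dots> = a \<otimes> \<sigma> g b"
    using assms by (simp add: skew_monom_def)
  finally show ?thesis .
qed

text \<open>
  On monomials this is \<open>a \<sigma>\<^sub>g(b \<sigma>\<^sub>h(c)) = a \<sigma>\<^sub>g(b) \<sigma>\<^sub>g\<^sub>h(c)\<close>, which uses that each \<open>\<sigma> g\<close> is a ring
  homomorphism and that \<open>\<sigma>\<close> is a group homomorphism. In general, exchange the two summations and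
  substitute \<open>y = g\<^sup>-\<^sup>1k\<close> in the sum over \<open>k\<close>.
\<close>

lemma skew_act_mult:
  assumes f: "f \<in> carrier S" and h: "h \<in> carrier S" and a: "a \<in> carrier R"
  shows "skew_act (f \<otimes>\<^bsub>S\<^esub> h) a = skew_act f (skew_act h a)"
proof -
  let ?A = "supp f" and ?B = "supp h"
  let ?C = "(\<lambda>(x, y). x \<cdot> y) ` (?A \<times> ?B)"
  have A: "?A \<subseteq> carrier G" "finite ?A" and B: "?B \<subseteq> carrier G" "finite ?B"
    using f h supp_sub by auto
  have C: "?C \<subseteq> carrier G" "finite ?C"
    using A B by auto
  note fh = S_mult_closed[OF f h]
  have "skew_act (f \<otimes>\<^bsub>S\<^esub> h) a = (\<Oplus>k\<in>?C. (f \<otimes>\<^bsub>S\<^esub> h) k \<otimes> \<sigma> k a)"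
    by (rule skew_act_supset[OF fh(1) a C(2) fh(2) C(1)])
  also have "\<dots> = (\<Oplus>k\<in>?C. \<Oplus>g\<in>?A. f g \<otimes> \<sigma> g (h (gi g \<cdot> k)) \<otimes> \<sigma> k a)"
  proof (rule R.finsum_cong')
    fix k assume "k \<in> ?C"
    then have k: "k \<in> carrier G" using C by blast
    have "(f \<otimes>\<^bsub>S\<^esub> h) k \<otimes> \<sigma> k a = (\<Oplus>g\<in>?A. f g \<otimes> \<sigma> g (h (gi g \<cdot> k))) \<otimes> \<sigma> k a"
      using S_mult_supset[OF f h k A(2) subset_refl A(1)] by simp
    also have "\<dots> = (\<Oplus>g\<in>?A. f g \<otimes> \<sigma> g (h (gi g \<cdot> k)) \<otimes> \<sigma> k a)"
      using A f h a k by (intro R.finsum_ldistr) (auto simp: subset_iff)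
    finally show "(f \<otimes>\<^bsub>S\<^esub> h) k \<otimes> \<sigma> k a = (\<Oplus>g\<in>?A. f g \<otimes> \<sigma> g (h (gi g \<cdot> k)) \<otimes> \<sigma> k a)" .
  next
    show "(\<lambda>k. \<Oplus>g\<in>?A. f g \<otimes> \<sigma> g (h (gi g \<cdot> k)) \<otimes> \<sigma> k a) \<in> ?C \<rightarrow> carrier R"
    proof (intro Pi_I R.finsum_closed)
      fix k g assume "k \<in> ?C" "g \<in> ?A"
      then have "k \<in> carrier G" "g \<in> carrier G" using A C by blast+
      then show "f g \<otimes> \<sigma> g (h (gi g \<cdot> k)) \<otimes> \<sigma> k a \<in> carrier R" using f h a by simp
    qed
  qed simp
  also have "\<dots> = (\<Oplus>g\<in>?A. \<Oplus>k\<in>?C. f g \<otimes> \<sigma> g (h (gi g \<cdot> k)) \<otimes> \<sigma> k a)"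
  proof (rule R.finsum_swap_finite[OF C(2) A(2)])
    fix k g assume "k \<in> ?C" "g \<in> ?A"
    then have "k \<in> carrier G" "g \<in> carrier G" using A C by blast+
    then show "f g \<otimes> \<sigma> g (h (gi g \<cdot> k)) \<otimes> \<sigma> k a \<in> carrier R" using f h a by simp
  qed
  also have "\<dots> = (\<Oplus>g\<in>?A. f g \<otimes> \<sigma> g (skew_act h a))"
  proof (rule R.finsum_cong')
    fix g assume gA: "g \<in> ?A"
    then have g: "g \<in> carrier G" using A by auto
    \<comment> \<open>The range of the substituted variable, which may exceed the support of \<open>h\<close>.\<close>
    let ?D = "(\<lambda>k. gi g \<cdot> k) ` ?C"
    have D: "finite ?D" "?D \<subseteq> carrier G" using C g by auto
    have inj: "inj_on (\<lambda>k. gi g \<cdot> k) ?C"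
      using g C(1) by (intro inj_on_subset[OF G.inj_on_cmult]) auto
    have BD: "?B \<subseteq> ?D"
    proof
      fix y assume y: "y \<in> ?B"
      then have "y = gi g \<cdot> (g \<cdot> y)" using g B by (simp flip: G.m_assoc add: subsetD)
      moreover have "g \<cdot> y \<in> ?C" using gA y by force
      ultimately show "y \<in> ?D" by (rule image_eqI)
    qed
    have "f g \<otimes> \<sigma> g (skew_act h a) = f g \<otimes> \<sigma> g (\<Oplus>y\<in>?D. h y \<otimes> \<sigma> y a)"
      using skew_act_supset[OF h a D(1) BD D(2)] by simp
    also have "(\<Oplus>y\<in>?D. h y \<otimes> \<sigma> y a) = (\<Oplus>k\<in>?C. h (gi g \<cdot> k) \<otimes> \<sigma> (gi g \<cdot> k) a)"
      using D h a inj by (intro R.finsum_reindex) (auto simp: subset_iff)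
    also have "\<sigma> g \<dots> = (\<Oplus>k\<in>?C. \<sigma> g (h (gi g \<cdot> k) \<otimes> \<sigma> (gi g \<cdot> k) a))"
    proof (intro sigma_finsum g C Pi_I)
      fix k assume "k \<in> ?C"
      then have "k \<in> carrier G" using C by blast
      then show "h (gi g \<cdot> k) \<otimes> \<sigma> (gi g \<cdot> k) a \<in> carrier R" using g h a by simp
    qed
    also have "f g \<otimes> \<dots> = (\<Oplus>k\<in>?C. f g \<otimes> \<sigma> g (h (gi g \<cdot> k) \<otimes> \<sigma> (gi g \<cdot> k) a))"
    proof (intro R.finsum_rdistr C Pi_I)
      fix k assume "k \<in> ?C"
      then have "k \<in> carrier G" using C by blast
      then show "\<sigma> g (h (gi g \<cdot> k) \<otimes> \<sigma> (gi g \<cdot> k) a) \<in> carrier R" using g h a by simp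
    qed (use f g in simp)
    also have "\<dots> = (\<Oplus>k\<in>?C. f g \<otimes> \<sigma> g (h (gi g \<cdot> k)) \<otimes> \<sigma> k a)"
    proof (rule R.finsum_cong')
      fix k assume "k \<in> ?C"
      then have k: "k \<in> carrier G" using C by blast
      have "\<sigma> g (\<sigma> (gi g \<cdot> k) a) = \<sigma> k a"
        using g k a by (simp flip: sigma_comp G.m_assoc)
      then show "f g \<otimes> \<sigma> g (h (gi g \<cdot> k) \<otimes> \<sigma> (gi g \<cdot> k) a)
          = f g \<otimes> \<sigma> g (h (gi g \<cdot> k)) \<otimes> \<sigma> k a"
        using f g h a k by (simp add: sigma_mult R.m_assoc)
    next
      show "(\<lambda>k. f g \<otimes> \<sigma> g (h (gi g \<cdot> k)) \<otimes> \<sigma> k a) \<in> ?C \<rightarrow> carrier R"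
      proof
        fix k assume "k \<in> ?C"
        then have "k \<in> carrier G" using C by blast
        then show "f g \<otimes> \<sigma> g (h (gi g \<cdot> k)) \<otimes> \<sigma> k a \<in> carrier R" using f g h a by simp
      qed
    qed simp
    finally show "(\<Oplus>k\<in>?C. f g \<otimes> \<sigma> g (h (gi g \<cdot> k)) \<otimes> \<sigma> k a) = f g \<otimes> \<sigma> g (skew_act h a)"
      by simp
  qed (use A f skew_act_closed[OF h a] in \<open>auto simp: subset_iff\<close>)
  finally show ?thesis
    by (simp add: skew_act_def[of f])
qed

definition skew_annihilator :: "('g \<Rightarrow> 'a) set"
  where "skew_annihilator = {f \<in> carrier S. \<forall>a\<in>carrier R. skew_act f a = \<zero>}"

text \<open>
  As for every left module, \<open>x (f a) = x 0\<close> gives closure on the left and \<open>f (x a) = 0\<close>, because \<open>x a\<close>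
  is again a module element, gives closure on the right.
\<close>

lemma ideal_skew_annihilator: "ideal skew_annihilator S"
proof -
  interpret S: ring S by (rule ring_skew_group_ring)
  have l: "x \<otimes>\<^bsub>S\<^esub> f \<in> skew_annihilator" if "f \<in> skew_annihilator" "x \<in> carrier S" for f x
    using that by (simp add: skew_annihilator_def skew_act_mult skew_act_zero_right)
  show ?thesis
  proof (rule idealI)
    show "subgroup skew_annihilator (add_monoid S)"
    proof (rule S.add.subgroupI)
      show "skew_annihilator \<subseteq> carrier S"
        by (auto simp: skew_annihilator_def)
      have "skew_act \<zero>\<^bsub>S\<^esub> a = \<zero>" for a
        by (simp add: skew_act_def skew_support_def S_zero cong: conj_cong)
      then show "skew_annihilator \<noteq> {}"
        using S.zero_closed by (auto simp: skew_annihilator_def)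
    next
      \<comment> \<open>Closure under negation is a case of closure under left multiplication.\<close>
      fix f assume f: "f \<in> skew_annihilator"
      then have "\<ominus>\<^bsub>S\<^esub> f = (\<ominus>\<^bsub>S\<^esub> \<one>\<^bsub>S\<^esub>) \<otimes>\<^bsub>S\<^esub> f"
        by (simp add: skew_annihilator_def S.l_minus)
      then show "\<ominus>\<^bsub>S\<^esub> f \<in> skew_annihilator"
        using l[OF f] by simp
    next
      fix f h assume "f \<in> skew_annihilator" "h \<in> skew_annihilator"
      then show "f \<oplus>\<^bsub>S\<^esub> h \<in> skew_annihilator"
        by (simp add: skew_annihilator_def skew_act_add)
    qed
  next
    fix f x assume "f \<in> skew_annihilator" "x \<in> carrier S"
    then show "f \<otimes>\<^bsub>S\<^esub> x \<in> skew_annihilator"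
      by (simp add: skew_annihilator_def skew_act_mult skew_act_closed)
  qed (use l S.ring_axioms in auto)
qed

text \<open>An element \<open>a\<close> of the coefficient ring is recovered from its action as the image of \<open>1\<close>.\<close>

lemma skew_annihilator_inter_base: "skew_annihilator \<inter> skew_base R G = {\<zero>\<^bsub>S\<^esub>}"
proof -
  interpret S: ring S by (rule ring_skew_group_ring)
  interpret J: ideal skew_annihilator S by (rule ideal_skew_annihilator)
  have "f = \<zero>\<^bsub>S\<^esub>" if "f \<in> skew_annihilator" "f \<in> skew_base R G" for f
  proof -
    obtain a where a: "a \<in> carrier R" "f = skew_monom R G a \<one>\<^bsub>G\<^esub>"
      using \<open>f \<in> skew_base R G\<close> by (auto simp: skew_base_def)
    have "skew_act f \<one> = a"
      using a by (simp add: skew_act_monom)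
    moreover have "skew_act f \<one> = \<zero>"
      using \<open>f \<in> skew_annihilator\<close> unfolding skew_annihilator_def by blast
    ultimately have "a = \<zero>"
      by (rule trans[OF sym])
    then show ?thesis
      unfolding a(2) by (intro S_eqI S_monom_closed) (simp_all add: skew_monom_one_apply S_zero)
  qed
  moreover have "\<zero>\<^bsub>S\<^esub> \<in> skew_base R G"
    by (simp add: mem_skew_base_iff S_zero)
  ultimately show ?thesis
    by auto
qed

end

section \<open>Commutative coefficients\<close>

locale comm_skew_system = skew_system R G \<sigma> + R: cring R
  for R :: "('a, 'm) ring_scheme" (structure) and G :: "('g, 'n) monoid_scheme" (structure)
    and \<sigma> :: "'g \<Rightarrow> 'a \<Rightarrow> 'a"
begin

lemma subcring_skew_base: "subcring (skew_base R G) S"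
proof -
  interpret S: ring S by (rule ring_skew_group_ring)
  show ?thesis
  proof (rule S.subcringI)
    show "subring (skew_base R G) S"
      unfolding skew_base_def
      by (rule ring_hom_ring.img_is_subring[OF ring_hom_skew_base R.carrier_is_subring])
    show "x \<otimes>\<^bsub>S\<^esub> y = y \<otimes>\<^bsub>S\<^esub> x" if "x \<in> skew_base R G" "y \<in> skew_base R G" for x y
      using that by (auto simp: skew_base_def S_monom_mult sigma_id R.m_comm)
  qed
qed

text \<open>
  Compare coefficients in \<open>x a = a x\<close>: at \<open>g\<close> they are \<open>x g \<sigma>\<^sub>g(a)\<close> and \<open>a (x g) = (x g) a\<close>. Each coefficient is
  constrained separately, so a single monomial of \<open>x\<close> already carries the information.
\<close>

lemma commutes_with_skew_base_iff:
  assumes x: "x \<in> carrier S"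
  shows "(\<forall>s\<in>skew_base R G. x \<otimes>\<^bsub>S\<^esub> s = s \<otimes>\<^bsub>S\<^esub> x)
    \<longleftrightarrow> (\<forall>g\<in>carrier G. \<forall>a\<in>carrier R. x g \<otimes> \<sigma> g a = x g \<otimes> a)"
proof -
  have "x \<otimes>\<^bsub>S\<^esub> skew_monom R G a \<one>\<^bsub>G\<^esub> = skew_monom R G a \<one>\<^bsub>G\<^esub> \<otimes>\<^bsub>S\<^esub> x
      \<longleftrightarrow> (\<forall>g\<in>carrier G. x g \<otimes> \<sigma> g a = x g \<otimes> a)" (is "?l = ?r \<longleftrightarrow> _")
    if a: "a \<in> carrier R" for a
  proof -
    have "?l = ?r \<longleftrightarrow> (\<forall>g\<in>carrier G. ?l g = ?r g)"
      using x a S_eqI[of ?l ?r] by (auto intro: S_mult_closed(1) S_monom_closed)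
    also have "\<dots> \<longleftrightarrow> (\<forall>g\<in>carrier G. x g \<otimes> \<sigma> g a = x g \<otimes> a)"
      using x a
      by (intro ball_cong) (auto simp: S_monom_mult_left skew_monom_mult_right sigma_id R.m_comm)
    finally show ?thesis .
  qed
  then show ?thesis
    unfolding skew_base_def by auto
qed

text \<open>
  If \<open>c\<close> is a nonzero coefficient of \<open>x\<close> at some \<open>g \<noteq> e\<close>, then \<open>u\<^sub>g\<close> and \<open>u\<^sub>e\<close> have the same action
  once multiplied by \<open>c\<close>, so their difference times \<open>c\<close> is a nonzero annihilating element.
\<close>

lemma skew_annihilator_nontrivial:
  assumes x: "x \<in> carrier S" and comm: "\<And>s. s \<in> skew_base R G \<Longrightarrow> x \<otimes>\<^bsub>S\<^esub> s = s \<otimes>\<^bsub>S\<^esub> x"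
    and notin: "x \<notin> skew_base R G"
  shows "skew_annihilator \<noteq> {\<zero>\<^bsub>S\<^esub>}"
proof -
  interpret S: ring S by (rule ring_skew_group_ring)
  obtain g where g: "g \<in> carrier G" "g \<noteq> \<one>\<^bsub>G\<^esub>" "x g \<noteq> \<zero>"
    using notin x by (auto simp: mem_skew_base_iff)
  define c where "c = x g"
  have c: "c \<in> carrier R" "c \<noteq> \<zero>"
    using x g by (simp_all add: c_def)
  have cg: "c \<otimes> \<sigma> g a = c \<otimes> a" if "a \<in> carrier R" for a
    using comm commutes_with_skew_base_iff[OF x] that g(1) by (auto simp: c_def)
  let ?p = "skew_monom R G (\<ominus> c) \<one>\<^bsub>G\<^esub>" and ?q = "skew_monom R G c g"
  have pq: "?p \<in> carrier S" "?q \<in> carrier S"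
    using c g by (auto intro: S_monom_closed)
  have "skew_act (?p \<oplus>\<^bsub>S\<^esub> ?q) a = \<zero>" if a: "a \<in> carrier R" for a
    using pq a c g by (simp add: skew_act_add skew_act_monom sigma_id cg R.l_minus R.l_neg)
  then have "?p \<oplus>\<^bsub>S\<^esub> ?q \<in> skew_annihilator"
    using pq by (simp add: skew_annihilator_def)
  moreover have "(?p \<oplus>\<^bsub>S\<^esub> ?q) g \<noteq> \<zero>\<^bsub>S\<^esub> g"
    using g c by (simp add: S_add S_zero skew_monom_def)
  ultimately show ?thesis
    by auto
qed

text \<open>
  Commuting with the base is obtained by descent on the size of the support: a commutator with a base
  element has smaller support than a minimal element whose coefficient at the neutral element is
  nonzero, since at least that coefficient cancels.
\<close>

lemma ideal_meets_maximal_commutative_base: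
  assumes max: "maximal_commutative_subring (skew_base R G) S"
    and I: "ideal I S" and nz: "I \<noteq> {\<zero>\<^bsub>S\<^esub>}"
  shows "I \<inter> skew_base R G \<noteq> {\<zero>\<^bsub>S\<^esub>}"
proof -
  interpret S: ring S by (rule ring_skew_group_ring)
  interpret I: ideal I S by (rule I)
  have "\<exists>f. f \<in> I \<and> f \<noteq> \<zero>\<^bsub>S\<^esub>"
    using nz I.zero_closed by blast
  then obtain f where f: "f \<in> I" "f \<noteq> \<zero>\<^bsub>S\<^esub>"
    and min: "\<And>h. h \<in> I \<Longrightarrow> h \<noteq> \<zero>\<^bsub>S\<^esub> \<Longrightarrow> card (supp f) \<le> card (supp h)"
    using ex_has_least_nat[of "\<lambda>f. f \<in> I \<and> f \<noteq> \<zero>\<^bsub>S\<^esub>" _ "\<lambda>f. card (supp f)"]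
    by (elim exE) metis
  have fS: "f \<in> carrier S" using f(1) I.a_subset by (rule subsetD[rotated])
  obtain g where g: "g \<in> carrier G" "f g \<noteq> \<zero>"
    using f fS S_eqI[of f "\<zero>\<^bsub>S\<^esub>"] by (auto simp: S_zero)
  \<comment> \<open>Translating the support by \<open>g\<^sup>-\<^sup>1\<close> keeps its size and brings \<open>g\<close> to the neutral element.\<close>
  define r where "r = f \<otimes>\<^bsub>S\<^esub> skew_monom R G \<one> (gi g)"
  have r: "r \<in> I" and rS: "r \<in> carrier S"
    using f fS g unfolding r_def by (auto intro!: I.I_r_closed S_monom_closed S_mult_closed(1))
  have r_apply: "r k = f (k \<cdot> g)" if "k \<in> carrier G" for k
    using that fS g by (simp add: r_def skew_monom_mult_right)
  have "supp r \<subseteq> (\<lambda>k. k \<cdot> gi g) ` supp f"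
  proof
    fix k assume "k \<in> supp r"
    then have "k \<in> carrier G" "f (k \<cdot> g) \<noteq> \<zero>"
      by (auto simp: skew_support_def r_apply)
    then have "k \<cdot> g \<in> supp f" "k = k \<cdot> g \<cdot> gi g"
      using g by (simp_all add: skew_support_def G.m_assoc)
    then show "k \<in> (\<lambda>k. k \<cdot> gi g) ` supp f" by blast
  qed
  then have card_r: "card (supp r) \<le> card (supp f)"
    using fS by (meson card_image_le card_mono finite_imageI le_trans supp_finite)
  have r1: "r \<one>\<^bsub>G\<^esub> \<noteq> \<zero>"
    using g by (simp add: r_apply)
  have "r \<otimes>\<^bsub>S\<^esub> s = s \<otimes>\<^bsub>S\<^esub> r" if s: "s \<in> skew_base R G" for s
  proof -
    obtain a where a: "a \<in> carrier R" "s = skew_monom R G a \<one>\<^bsub>G\<^esub>"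
      using s by (auto simp: skew_base_def)
    have sS: "s \<in> carrier S" using a by (simp add: S_monom_closed)
    let ?d = "r \<otimes>\<^bsub>S\<^esub> s \<ominus>\<^bsub>S\<^esub> s \<otimes>\<^bsub>S\<^esub> r"
    have d: "?d \<in> I"
      using r sS by (simp add: a_minus_def I.I_l_closed I.I_r_closed I.a_closed I.a_inv_closed)
    have d_apply: "?d k = r k \<otimes> \<sigma> k a \<ominus> a \<otimes> r k" if "k \<in> carrier G" for k
      using that a rS sS S_monom_mult_left[OF a(1) G.one_closed rS that]
        skew_monom_mult_right[OF rS a(1) G.one_closed that]
      by (simp add: skew_minus_apply sigma_id)
    have "supp ?d \<subseteq> supp r - {\<one>\<^bsub>G\<^esub>}"
    proof
      fix k assume k: "k \<in> supp ?d"
      then have kG: "k \<in> carrier G" and nz: "r k \<otimes> \<sigma> k a \<ominus> a \<otimes> r k \<noteq> \<zero>"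
        by (auto simp: skew_support_def d_apply)
      have "r k \<noteq> \<zero>" using nz kG a by auto
      moreover have "k \<noteq> \<one>\<^bsub>G\<^esub>" using nz rS a by (auto simp: sigma_id R.m_comm)
      ultimately show "k \<in> supp r - {\<one>\<^bsub>G\<^esub>}" using kG by (simp add: skew_support_def)
    qed
    moreover have "\<one>\<^bsub>G\<^esub> \<in> supp r" using r1 by (simp add: skew_support_def)
    ultimately have "card (supp ?d) < card (supp r)"
      using rS by (intro psubset_card_mono) auto
    then have "?d = \<zero>\<^bsub>S\<^esub>"
      using min[OF d] card_r by linarith
    then show ?thesis
      using rS sS by simp
  qed
  then have "r \<in> skew_base R G"
    using max rS by (auto simp: maximal_commutative_subring_def)
  moreover have "r \<noteq> \<zero>\<^bsub>S\<^esub>"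
    using r1 by (auto simp: S_zero)
  ultimately show ?thesis
    using r by blast
qed

end

theorem theorem3p4:
  fixes R\<^sub>e :: "('a, 'm) ring_scheme" and G :: "('g, 'n) monoid_scheme"
    and \<sigma> :: "'g \<Rightarrow> 'a \<Rightarrow> 'a"
  assumes "cring R\<^sub>e"
    and "group G"
    and "\<sigma> \<in> hom G (ring_AutoGroup R\<^sub>e)"
  shows "maximal_commutative_subring (skew_base R\<^sub>e G) (skew_group_ring R\<^sub>e G \<sigma>)
    \<longleftrightarrow> (\<forall>I. ideal I (skew_group_ring R\<^sub>e G \<sigma>) \<and> I \<noteq> {\<zero>\<^bsub>skew_group_ring R\<^sub>e G \<sigma>\<^esub>}
          \<longrightarrow> I \<inter> skew_base R\<^sub>e G \<noteq> {\<zero>\<^bsub>skew_group_ring R\<^sub>e G \<sigma>\<^esub>})"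
    (is "?max \<longleftrightarrow> ?meet")
proof -
  interpret R: cring "R\<^sub>e" by fact
  interpret G: group G by fact
  interpret comm_skew_system "R\<^sub>e" G \<sigma>
    by unfold_locales fact
  show ?thesis
  proof
    assume ?max
    then show ?meet
      using ideal_meets_maximal_commutative_base by blast
  next
    assume ?meet
    then have "skew_annihilator = {\<zero>\<^bsub>S\<^esub>}"
      using ideal_skew_annihilator skew_annihilator_inter_base by blast
    then show ?max
      using subcring_skew_base skew_annihilator_nontrivial
      unfolding maximal_commutative_subring_def by blast
  qed
qed

end
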